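(* The sequence $s_{3/2}=(s_{3/2}(N))_{N\ge0}$ is the fixed point starting with $0$ of the $2$-$3$-block substitution on the alphabet $\{0,1,2,\dots\}$ given by $$a\,b \mapsto a,\ a+1,\ a+2 \qquad \text{for all } a,b\in\{0,1,2,\dots\}.$$
   Context: Every natural number $N$ can be written uniquely (ignoring leading zeros) as $N=\sum_{i=0}^{R} d_i (3/2)^i$ with digits $d_i\in\{0,1,2\}$; this is the base $3/2$ representation of $N$, and $s_{3/2}(N)=\sum_{i=0}^R d_i$ (with $s_{3/2}(0)=0$). A $2$-$3$-block substitution $\kappa$ on a (possibly infinite) alphabet $A$ assigns to each word $ab$ of length 2 over $A$ a word $\kappa(ab)$ of length 3; it acts on an infinite sequence $x=x_0x_1x_2\dots$ by $\kappa(x)=y$ where $y_{3k}y_{3k+1}y_{3k+2}=\kappa(x_{2k}x_{2k+1})$ for $k\ge0$. A fixed point of $\kappa$ is a sequence $x$ with $\kappa(x)=x$. *)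

theory Defs
  imports Complex_Main
begin

(* Digit lists are least significant digit first: ds ! i is the digit d_i. The condition
   on the last entry excludes leading zeros, so 0 is represented by the empty list. *)
definition base32_rep :: "nat \<Rightarrow> nat list \<Rightarrow> bool" where
  "base32_rep N ds \<longleftrightarrow>
     set ds \<subseteq> {0, 1, 2} \<and>
     (ds \<noteq> [] \<longrightarrow> last ds \<noteq> 0) \<and>
     (of_nat N :: rat) = (\<Sum>i<length ds. of_nat (ds ! i) * (3 / 2) ^ i)"

(* The description is proper, see base32_rep_ex1 below. *)
definition base32_digits :: "nat \<Rightarrow> nat list" where
  "base32_digits N = (THE ds. base32_rep N ds)"

definition s32 :: "nat \<Rightarrow> nat" where
  "s32 N = sum_list (base32_digits N)"

type_synonym 'a block_subst_23 = "'a \<times> 'a \<Rightarrow> 'a \<times> 'a \<times> 'a"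

definition apply_block_subst :: "'a block_subst_23 \<Rightarrow> (nat \<Rightarrow> 'a) \<Rightarrow> (nat \<Rightarrow> 'a)" where
  "apply_block_subst \<kappa> x n =
     (case \<kappa> (x (2 * (n div 3)), x (2 * (n div 3) + 1)) of
        (u, v, w) \<Rightarrow> if n mod 3 = 0 then u else if n mod 3 = 1 then v else w)"

definition is_fixed_point :: "'a block_subst_23 \<Rightarrow> (nat \<Rightarrow> 'a) \<Rightarrow> bool" where
  "is_fixed_point \<kappa> x \<longleftrightarrow> apply_block_subst \<kappa> x = x"

definition \<kappa>32 :: "nat block_subst_23" where
  "\<kappa>32 = (\<lambda>(a, b). (a, a + 1, a + 2))"

lemma apply_block_subst_blocks:
  "(apply_block_subst \<kappa> x (3 * k), apply_block_subst \<kappa> x (3 * k + 1),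
    apply_block_subst \<kappa> x (3 * k + 2)) = \<kappa> (x (2 * k), x (2 * k + 1))"
proof -
  have "(3 * k + 1) div 3 = k" "(3 * k + 2) div 3 = k"
    "(3 * k + 1) mod 3 = 1" "(3 * k + 2) mod 3 = 2"
    by presburger+
  then show ?thesis
    by (simp add: apply_block_subst_def split: prod.split)
qed

definition base32_val :: "nat list \<Rightarrow> rat" where
  "base32_val ds = (\<Sum>i<length ds. of_nat (ds ! i) * (3 / 2) ^ i)"

lemma base32_val_Nil: "base32_val [] = 0"
  by (simp add: base32_val_def)

lemma base32_val_Cons: "base32_val (d # ds) = of_nat d + 3 / 2 * base32_val ds"
  unfolding base32_val_def length_Cons sum.lessThan_Suc_shift
  by (simp add: sum_distrib_left mult_ac)

lemma base32_val_nonneg: "base32_val ds \<ge> 0"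
  by (induction ds) (simp_all add: base32_val_Nil base32_val_Cons)

lemma base32_val_pos: "ds \<noteq> [] \<Longrightarrow> last ds \<noteq> 0 \<Longrightarrow> base32_val ds > 0"
proof (induction ds)
  case (Cons d ds)
  show ?case
  proof (cases "ds = []")
    case True
    with Cons.prems show ?thesis by (simp add: base32_val_Nil base32_val_Cons)
  next
    case False
    with Cons have "base32_val ds > 0" by simp
    then show ?thesis by (simp add: base32_val_Cons add_nonneg_pos)
  qed
qed simp

lemma base32_val_denom: "\<exists>z::int. 2 ^ length ds * base32_val ds = of_int z"
proof (induction ds)
  case Nil
  show ?case by (intro exI[of _ 0]) (simp add: base32_val_Nil)
next
  case (Cons d ds)
  then obtain z :: int where z: "2 ^ length ds * base32_val ds = of_int z" by blast
  have "2 ^ length (d # ds) * base32_val (d # ds)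
      = 2 ^ length (d # ds) * of_nat d + 3 * (2 ^ length ds * base32_val ds)"
    by (simp add: base32_val_Cons algebra_simps)
  also have "\<dots> = of_int (2 ^ length (d # ds) * int d + 3 * z)"
    by (simp add: z)
  finally show ?case by blast
qed

lemma base32_val_cong:
  assumes "base32_val (d # ds) = base32_val (e # es)" and "d \<in> {0, 1, 2}" and "e \<in> {0, 1, 2}"
  shows "d = e"
proof -
  obtain y z :: int where y: "2 ^ length ds * base32_val ds = of_int y"
    and z: "2 ^ length es * base32_val es = of_int z"
    using base32_val_denom by blast
  define m n where "m = length ds" and "n = length es"
  have "2 ^ (m + n + 1) * base32_val (d # ds)
      = 2 ^ (m + n + 1) * of_nat d + 3 * (2 ^ n * (2 ^ m * base32_val ds))"
    by (simp add: base32_val_Cons algebra_simps power_add)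
  also have "\<dots> = of_int (2 ^ (m + n + 1) * int d + 3 * (2 ^ n * y))"
    by (simp add: y m_def)
  finally have 1: "2 ^ (m + n + 1) * base32_val (d # ds)
      = of_int (2 ^ (m + n + 1) * int d + 3 * (2 ^ n * y))" .
  have "2 ^ (m + n + 1) * base32_val (e # es)
      = 2 ^ (m + n + 1) * of_nat e + 3 * (2 ^ m * (2 ^ n * base32_val es))"
    by (simp add: base32_val_Cons algebra_simps power_add)
  also have "\<dots> = of_int (2 ^ (m + n + 1) * int e + 3 * (2 ^ m * z))"
    by (simp add: z n_def)
  finally have 2: "2 ^ (m + n + 1) * base32_val (e # es)
      = of_int (2 ^ (m + n + 1) * int e + 3 * (2 ^ m * z))" .
  have "2 ^ (m + n + 1) * int d + 3 * (2 ^ n * y)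
      = 2 ^ (m + n + 1) * int e + 3 * (2 ^ m * z)"
    by (rule of_int_eq_iff[where 'a = rat, THEN iffD1])
      (use 1[symmetric] 2[symmetric] assms(1) in \<open>simp only:\<close>)
  then have "2 ^ (m + n + 1) * (int d - int e) = 3 * (2 ^ m * z - 2 ^ n * y)"
    by (simp add: algebra_simps)
  then have "3 dvd 2 ^ (m + n + 1) * (int d - int e)"
    by (rule dvdI)
  moreover have "coprime (3::int) (2 ^ (m + n + 1))"
    by simp
  ultimately have "3 dvd int d - int e"
    using coprime_dvd_mult_right_iff by blast
  with assms(2,3) show ?thesis by auto
qed

lemma base32_val_inj:
  assumes "base32_val ds = base32_val es"
    and "set ds \<subseteq> {0, 1, 2}" and "ds \<noteq> [] \<longrightarrow> last ds \<noteq> 0"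
    and "set es \<subseteq> {0, 1, 2}" and "es \<noteq> [] \<longrightarrow> last es \<noteq> 0"
  shows "ds = es"
  using assms
proof (induction ds arbitrary: es)
  case Nil
  then show ?case using base32_val_pos[of es] by (auto simp: base32_val_Nil)
next
  case (Cons d ds)
  from Cons.prems base32_val_pos[of "d # ds"] have "es \<noteq> []"
    by (auto simp: base32_val_Nil)
  then obtain e es' where es: "es = e # es'" by (cases es) auto
  have "d = e"
    by (rule base32_val_cong) (use Cons.prems es in auto)
  moreover have "ds = es'"
  proof (rule Cons.IH)
    show "base32_val ds = base32_val es'"
      using Cons.prems(1) \<open>d = e\<close> by (simp add: es base32_val_Cons)
  qed (use Cons.prems es in \<open>auto split: if_splits\<close>)
  ultimately show ?case by (simp add: es)
qed

lemma base32_rep_exists: "\<exists>ds. base32_rep N ds"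
proof (induction N rule: less_induct)
  case (less N)
  show ?case
  proof (cases "N = 0")
    case True
    then show ?thesis by (intro exI[of _ "[]"]) (simp add: base32_rep_def)
  next
    case False
    define k where "k = N div 3"
    have "2 * k < N" using False unfolding k_def by presburger
    with less obtain ds where ds: "base32_rep (2 * k) ds" by blast
    have N: "N = 3 * k + N mod 3" by (simp add: k_def)
    have "(of_nat N :: rat) = 3 * of_nat k + of_nat (N mod 3)"
      by (metis N of_nat_add of_nat_mult of_nat_numeral)
    moreover have "base32_val ds = 2 * of_nat k"
      using ds by (simp add: base32_rep_def base32_val_def)
    ultimately have "of_nat N = base32_val (N mod 3 # ds)"
      by (simp add: base32_val_Cons)
    moreover have "N mod 3 \<in> {0, 1, 2}" by auto
    moreover have "N mod 3 \<noteq> 0" if "ds = []"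
    proof -
      from that ds have "k = 0" by (simp add: base32_rep_def)
      with N False show ?thesis by linarith
    qed
    ultimately have "base32_rep N (N mod 3 # ds)"
      using ds by (auto simp: base32_rep_def base32_val_def)
    then show ?thesis by blast
  qed
qed

lemma base32_rep_ex1: "\<exists>!ds. base32_rep N ds"
proof (rule ex_ex1I)
  show "\<exists>ds. base32_rep N ds" by (rule base32_rep_exists)
next
  fix ds es
  assume "base32_rep N ds" "base32_rep N es"
  then show "ds = es"
    by (intro base32_val_inj) (simp_all add: base32_rep_def base32_val_def)
qed

end

theory Submission imports Defs begin

text \<open>
  If \<open>N = 3k + r\<close> with \<open>r < 3\<close>, the base 3/2 representation of \<open>N\<close> is that of \<open>2k\<close> with the
  digit \<open>r\<close> prepended, so that \<open>s(3k + r) = s(2k) + r\<close>. The fixed point equation of the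
  substitution is exactly this recursion; as \<open>2k < N\<close> for \<open>N > 0\<close>, it determines a sequence from
  its value at \<open>0\<close>.
\<close>

lemma base32_rep_Cons:
  assumes "base32_rep (2 * k) ds" and "r < 3" and "3 * k + r \<noteq> 0"
  shows "base32_rep (3 * k + r) (r # ds)"
proof -
  have val: "base32_val ds = 2 * of_nat k"
    using assms(1) by (simp add: base32_rep_def base32_val_def)
  then have "of_nat (3 * k + r) = base32_val (r # ds)"
    by (simp add: base32_val_Cons)
  \<comment> \<open>Here \<open>r\<close> is the leading digit; the value equation gives
    \<open>k = 0\<close>, so the third assumption rules out \<open>r = 0\<close>.\<close>
  moreover have "r \<noteq> 0" if "ds = []"
    using val that assms(3) by (simp add: base32_val_Nil)
  moreover have "r \<in> {0, 1, 2}"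
    using assms(2) by auto
  ultimately show ?thesis
    using assms(1) by (auto simp: base32_rep_def base32_val_def)
qed

lemma base32_rep_base32_digits: "base32_rep N (base32_digits N)"
  unfolding base32_digits_def by (rule theI') (rule base32_rep_ex1)

lemma base32_digits_eqI: "base32_rep N ds \<Longrightarrow> base32_digits N = ds"
  unfolding base32_digits_def by (rule the1_equality[OF base32_rep_ex1])

lemma s32_0: "s32 0 = 0"
  using base32_digits_eqI[of 0 "[]"] by (simp add: s32_def base32_rep_def)

lemma s32_rec: "s32 N = s32 (2 * (N div 3)) + N mod 3"
\<comment> \<open>Zero is split off because its representation is \<open>[]\<close> and not
  \<open>[0]\<close>; there both sides are \<open>s32 0\<close>.\<close>
proof (cases "N = 0")
  case False
  have "base32_rep (3 * (N div 3) + N mod 3) (N mod 3 # base32_digits (2 * (N div 3)))"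
    by (rule base32_rep_Cons[OF base32_rep_base32_digits]) (use False in simp_all)
  then have "base32_digits N = N mod 3 # base32_digits (2 * (N div 3))"
    by (intro base32_digits_eqI) simp
  then show ?thesis
    by (simp add: s32_def)
qed simp

text \<open>The letters of an image block exceed its first letter by 0, 1, 2 in turn, which is the
  offset of \<open>n\<close> in its block.\<close>

lemma apply_block_subst_\<kappa>32:
  "apply_block_subst \<kappa>32 x n = x (2 * (n div 3)) + n mod 3"
proof -
  have "n mod 3 < 3" by simp
  then have "n mod 3 = 0 \<or> n mod 3 = 1 \<or> n mod 3 = 2" by linarith
  then show ?thesis
    by (auto simp: apply_block_subst_def \<kappa>32_def)
qed

lemma is_fixed_point_\<kappa>32_iff:
  "is_fixed_point \<kappa>32 x \<longleftrightarrow> (\<forall>n. x n = x (2 * (n div 3)) + n mod 3)"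
  unfolding is_fixed_point_def fun_eq_iff apply_block_subst_\<kappa>32 by (simp only: eq_commute)

text \<open>At \<open>n = 0\<close> the recursion reads \<open>x 0 = x 0\<close> and leaves the
  initial value free; every other index refers to a smaller one.\<close>

lemma is_fixed_point_\<kappa>32_unique:
  assumes "is_fixed_point \<kappa>32 x" and "is_fixed_point \<kappa>32 y" and "x 0 = y 0"
  shows "x = y"
proof
  fix n
  show "x n = y n"
  proof (induction n rule: less_induct)
    case (less n)
    show ?case
    proof (cases "n = 0")
      case False
      then have "2 * (n div 3) < n" by presburger
      then show ?thesis
        using less.IH assms(1,2)[unfolded is_fixed_point_\<kappa>32_iff, THEN spec, of n] by simp
    qed (simp add: assms(3))
  qed
qed

theorem theorem2:
  "is_fixed_point \<kappa>32 s32 \<and> s32 0 = 0 \<and>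
   (\<forall>x. is_fixed_point \<kappa>32 x \<and> x 0 = 0 \<longrightarrow> x = s32)"
proof -
  have "is_fixed_point \<kappa>32 s32"
    unfolding is_fixed_point_\<kappa>32_iff by (intro allI s32_rec)
  then show ?thesis
    by (simp add: is_fixed_point_\<kappa>32_unique s32_0)
qed

end
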